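(* Fix a finite alphabet $\Sigma$ containing a root label $r$ and a DTD $D$ over $\Sigma$. There is a deterministic one-pass streaming algorithm (with no auxiliary streams) which, given as input stream the XML sequence $\mathrm{XML}(t)$ of a binary tree $t$ with $N$ nodes, decides whether $t$ is valid against $D$, using $\mathrm{O}(\sqrt{N\log N})$ space and $\mathrm{O}(1)$ processing time per letter.
   Context: Trees: finite rooted ordered trees whose nodes are labeled by letters of $\Sigma$, the root being labeled $r$. A binary tree is one in which every node is either a leaf or has exactly two children. For each $a\in\Sigma$ there is an opening tag $a$ and a closing tag $\bar a$. The XML sequence $\mathrm{XML}(t)$ of a tree $t$ is the sequence of tags obtained from a depth-first (left-to-right) traversal of $t$, writing the opening tag of a node's label when the node is first entered and its closing tag when it is left; it has length $2N$ if $t$ has $N$ nodes. The input is assumed well-formed, i.e. it equals $\mathrm{XML}(t)$ for some tree $t$, and its length is known in advance. A DTD is a map $D$ from $\Sigma$ to regular expressions over $\Sigma$; a node labeled $a$ whose children (in order) are labeled $a_1,\dots,a_k$ is valid against $D$ if the word $a_1\cdots a_k$ matches $D(a)$ (a leaf is valid iff the empty word matches $D(a)$); $t$ is valid against $D$ if all its nodes are. The DTD is fixed and not counted in the space. Streaming model: the input stream is read sequentially letter by letter; a pass is one sequential scan; the algorithm keeps an internal memory whose size (in letters of the alphabet and bits) is the space; the processing time per letter is the maximal running time between two consecutive read/write operations; arithmetic on integers in $[0,2N]$ takes constant time. *)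

theory Defs
  imports "HOL-Library.Landau_Symbols" "HOL-Library.Log_Nat"
begin

section \<open>Trees, XML sequences and DTDs\<close>

datatype 'a tree = Node (label: 'a) (children: "'a tree list")

datatype 'a tag = Open 'a | Close 'a

fun nodes :: "'a tree \<Rightarrow> nat" where
  "nodes (Node a ts) = 1 + sum_list (map nodes ts)"

fun binary :: "'a tree \<Rightarrow> bool" where
  "binary (Node a ts) \<longleftrightarrow> (ts = [] \<or> length ts = 2) \<and> (\<forall>t \<in> set ts. binary t)"

fun xml :: "'a tree \<Rightarrow> 'a tag list" where
  "xml (Node a ts) = Open a # concat (map xml ts) @ [Close a]"

lemma length_xml: "length (xml t) = 2 * nodes t"
proof (induction t)
  case (Node a ts)
  then have "sum_list (map (length \<circ> xml) ts) = 2 * sum_list (map nodes ts)"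
    by (induction ts) auto
  then show ?case by (simp add: length_concat)
qed

datatype 'a rexp =
    Zero
  | One
  | Atom 'a
  | Alt "'a rexp" "'a rexp"
  | Conc "'a rexp" "'a rexp"
  | Star "'a rexp"

fun lang :: "'a rexp \<Rightarrow> 'a list set" where
  "lang Zero = {}"
| "lang One = {[]}"
| "lang (Atom a) = {[a]}"
| "lang (Alt e f) = lang e \<union> lang f"
| "lang (Conc e f) = {u @ v | u v. u \<in> lang e \<and> v \<in> lang f}"
| "lang (Star e) = {concat us | us. set us \<subseteq> lang e}"

type_synonym 'a dtd = "'a \<Rightarrow> 'a rexp"

fun valid :: "'a dtd \<Rightarrow> 'a tree \<Rightarrow> bool" where
  "valid D (Node a ts) \<longleftrightarrow> map label ts \<in> lang (D a) \<and> (\<forall>t \<in> set ts. valid D t)"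


section \<open>Deterministic one-pass streaming algorithms\<close>

text \<open>
  A streaming algorithm is a program for a random access machine with a read-once input tape.
  The machine has two kinds of storage: integer storage, whose entries are integers in
  \<open>{0..M}\<close> (\<open>M\<close> being the length of the input stream), and letter storage, whose entries are
  tags or blank. Each kind consists of the registers named in the program and of a memory
  addressed by integers. There are no auxiliary streams.

  A function or predicate on letters that appears in a program is applied to a fixed number of
  registers. As the alphabet is finite it is a finite table, hence part of the finite control.
\<close>

type_synonym 'a letter = "'a tag option"

datatype arith_op = Plus | Minus | Times | Div | Mod

datatype 'a test =
    Leq nat nat
  | Letters "'a letter list \<Rightarrow> bool" "nat list"

datatype 'a com =
    Skip
  | IConst nat nat
  | IArith nat arith_op nat nat
  | ILoad nat nat
  | IStore nat nat
  | LApply nat "'a letter list \<Rightarrow> 'a letter" "nat list"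
  | LLoad nat nat
  | LStore nat nat
  | Read nat
  | Seq "'a com" "'a com"
  | Cond "'a test" "'a com" "'a com"
  | Loop "'a test" "'a com"

text \<open>
  Besides the actual machine state, a state records the resources used so far.
  \<open>icells\<close> and \<open>lcells\<close> are the least \<open>n\<close> such that all memory accesses (reads or writes) so far
  were at addresses below \<open>n\<close>; so the cells lying below an accessed one are charged for as well.
  \<open>laps\<close> lists, most recent first, the running times of the segments into which the read
  operations cut the run; its last entry is the time spent before the first read.
\<close>

record 'a state =
  ireg :: "nat \<Rightarrow> nat"
  lreg :: "nat \<Rightarrow> 'a letter"
  imem :: "nat \<Rightarrow> nat"
  lmem :: "nat \<Rightarrow> 'a letter"
  stream :: "'a tag list"
  icells :: nat
  lcells :: nat
  laps :: "nat list"

text \<open>Initially, integer register 0 holds the length of the input.\<close>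

definition init :: "'a tag list \<Rightarrow> 'a state" where
  "init w = \<lparr>ireg = (\<lambda>_. 0)(0 := length w), lreg = (\<lambda>_. None),
             imem = (\<lambda>_. 0), lmem = (\<lambda>_. None),
             stream = w, icells = 0, lcells = 0, laps = [0]\<rparr>"

definition tick :: "'a state \<Rightarrow> 'a state" where
  "tick s = s\<lparr>laps := Suc (hd (laps s)) # tl (laps s)\<rparr>"

definition itouch :: "nat \<Rightarrow> 'a state \<Rightarrow> 'a state" where
  "itouch p s = s\<lparr>icells := max (icells s) (Suc p)\<rparr>"

definition ltouch :: "nat \<Rightarrow> 'a state \<Rightarrow> 'a state" where
  "ltouch p s = s\<lparr>lcells := max (lcells s) (Suc p)\<rparr>"

fun arith :: "arith_op \<Rightarrow> nat \<Rightarrow> nat \<Rightarrow> nat" where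
  "arith Plus m n = m + n"
| "arith Minus m n = m - n"
| "arith Times m n = m * n"
| "arith Div m n = m div n"
| "arith Mod m n = m mod n"

fun holds :: "'a test \<Rightarrow> 'a state \<Rightarrow> bool" where
  "holds (Leq x y) s \<longleftrightarrow> ireg s x \<le> ireg s y"
| "holds (Letters P xs) s \<longleftrightarrow> P (map (lreg s) xs)"

text \<open>
  \<open>exec M c s s'\<close>: started in \<open>s\<close>, the command \<open>c\<close> terminates in \<open>s'\<close>. There is no such \<open>s'\<close>
  if the run diverges, produces an integer exceeding \<open>M\<close>, or reads beyond the end of the stream.
\<close>

inductive exec :: "nat \<Rightarrow> 'a com \<Rightarrow> 'a state \<Rightarrow> 'a state \<Rightarrow> bool" for M :: nat where
  Skip: "exec M Skip s s"
| IConst: "n \<le> M \<Longrightarrow>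
    exec M (IConst x n) s (tick (s\<lparr>ireg := (ireg s)(x := n)\<rparr>))"
| IArith: "n = arith f (ireg s y) (ireg s z) \<Longrightarrow> n \<le> M \<Longrightarrow>
    exec M (IArith x f y z) s (tick (s\<lparr>ireg := (ireg s)(x := n)\<rparr>))"
| ILoad: "p = ireg s y \<Longrightarrow>
    exec M (ILoad x y) s (tick (itouch p (s\<lparr>ireg := (ireg s)(x := imem s p)\<rparr>)))"
| IStore: "p = ireg s x \<Longrightarrow>
    exec M (IStore x y) s (tick (itouch p (s\<lparr>imem := (imem s)(p := ireg s y)\<rparr>)))"
| LApply: "exec M (LApply x f ys) s (tick (s\<lparr>lreg := (lreg s)(x := f (map (lreg s) ys))\<rparr>))"
| LLoad: "p = ireg s y \<Longrightarrow>
    exec M (LLoad x y) s (tick (ltouch p (s\<lparr>lreg := (lreg s)(x := lmem s p)\<rparr>)))"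
| LStore: "p = ireg s x \<Longrightarrow>
    exec M (LStore x y) s (tick (ltouch p (s\<lparr>lmem := (lmem s)(p := lreg s y)\<rparr>)))"
| Read: "stream s = a # w \<Longrightarrow>
    exec M (Read x) s (s\<lparr>stream := w, lreg := (lreg s)(x := Some a), laps := 0 # laps s\<rparr>)"
| Seq: "exec M c s s' \<Longrightarrow> exec M d s' s'' \<Longrightarrow> exec M (Seq c d) s s''"
| CondTrue: "holds b s \<Longrightarrow> exec M c (tick s) s' \<Longrightarrow> exec M (Cond b c d) s s'"
| CondFalse: "\<not> holds b s \<Longrightarrow> exec M d (tick s) s' \<Longrightarrow> exec M (Cond b c d) s s'"
| LoopFalse: "\<not> holds b s \<Longrightarrow> exec M (Loop b c) s (tick s)"
| LoopTrue: "holds b s \<Longrightarrow> exec M c (tick s) s' \<Longrightarrow> exec M (Loop b c) s' s'' \<Longrightarrow>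
    exec M (Loop b c) s s''"

lemma exec_deterministic: "exec M c s s1 \<Longrightarrow> exec M c s s2 \<Longrightarrow> s1 = s2"
proof (induction arbitrary: s2 rule: exec.induct)
  case (Seq c s s' d s'')
  from Seq.prems obtain t where "exec M c s t" "exec M d t s2" by cases
  with Seq.IH show ?case by blast
next
  case (CondTrue b s c s' d)
  from CondTrue.prems CondTrue.hyps(1) have "exec M c (tick s) s2" by cases blast+
  with CondTrue.IH show ?case by blast
next
  case (CondFalse b s d s' c)
  from CondFalse.prems CondFalse.hyps(1) have "exec M d (tick s) s2" by cases blast+
  with CondFalse.IH show ?case by blast
next
  case (LoopTrue b s c s' s'')
  from LoopTrue.prems LoopTrue.hyps(1)
  obtain t where "exec M c (tick s) t" "exec M (Loop b c) t s2" by cases blast+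
  with LoopTrue.IH show ?case by blast
next
  case (LoopFalse b s c)
  from LoopFalse.prems LoopFalse.hyps show ?case by cases blast+
next
  case Skip
  from Skip.prems show ?case by cases simp
next
  case IConst
  from IConst.prems show ?case by cases simp
next
  case IArith
  from IArith.prems IArith.hyps show ?case by cases simp
next
  case ILoad
  from ILoad.prems ILoad.hyps show ?case by cases simp
next
  case IStore
  from IStore.prems IStore.hyps show ?case by cases simp
next
  case LApply
  from LApply.prems show ?case by cases simp
next
  case LLoad
  from LLoad.prems LLoad.hyps show ?case by cases simp
next
  case LStore
  from LStore.prems LStore.hyps show ?case by cases simp
next
  case Read
  from Read.prems Read.hyps show ?case by cases simp
qed

text \<open>The answer is given in integer register 0, at the end of the run.\<close>

definition accepting :: "'a state \<Rightarrow> bool" where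
  "accepting s \<longleftrightarrow> ireg s 0 = 1"

fun test_iregs :: "'a test \<Rightarrow> nat set" where
  "test_iregs (Leq x y) = {x, y}"
| "test_iregs (Letters P xs) = {}"

fun test_lregs :: "'a test \<Rightarrow> nat set" where
  "test_lregs (Leq x y) = {}"
| "test_lregs (Letters P xs) = set xs"

fun iregs :: "'a com \<Rightarrow> nat set" where
  "iregs Skip = {}"
| "iregs (IConst x n) = {x}"
| "iregs (IArith x f y z) = {x, y, z}"
| "iregs (ILoad x y) = {x, y}"
| "iregs (IStore x y) = {x, y}"
| "iregs (LApply x f ys) = {}"
| "iregs (LLoad x y) = {y}"
| "iregs (LStore x y) = {x}"
| "iregs (Read x) = {}"
| "iregs (Seq c d) = iregs c \<union> iregs d"
| "iregs (Cond b c d) = test_iregs b \<union> iregs c \<union> iregs d"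
| "iregs (Loop b c) = test_iregs b \<union> iregs c"

fun lregs :: "'a com \<Rightarrow> nat set" where
  "lregs Skip = {}"
| "lregs (IConst x n) = {}"
| "lregs (IArith x f y z) = {}"
| "lregs (ILoad x y) = {}"
| "lregs (IStore x y) = {}"
| "lregs (LApply x f ys) = insert x (set ys)"
| "lregs (LLoad x y) = {x}"
| "lregs (LStore x y) = {y}"
| "lregs (Read x) = {x}"
| "lregs (Seq c d) = lregs c \<union> lregs d"
| "lregs (Cond b c d) = test_lregs b \<union> lregs c \<union> lregs d"
| "lregs (Loop b c) = test_lregs b \<union> lregs c"

text \<open>
  Space of a run of \<open>c\<close> with final state \<open>s\<close>. A letter counts 1, and an integer in \<open>{0..M}\<close> counts
  \<open>ceillog2 (M + 1)\<close> bits whatever its value. Storage is never released, so the final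
  state determines the space of the whole run.
\<close>

definition space_used :: "nat \<Rightarrow> 'a com \<Rightarrow> 'a state \<Rightarrow> nat" where
  "space_used M c s =
     (card (insert 0 (iregs c)) + icells s) * ceillog2 (M + 1) + (card (lregs c) + lcells s)"

text \<open>
  Maximal running time between two consecutive read/write operations, the write being that of
  the answer at the end of the run. The initialisation preceding the first read is not between
  two such operations.
\<close>

definition processing_time :: "'a state \<Rightarrow> nat" where
  "processing_time s = Max (insert 0 (set (butlast (laps s))))"

end

theory Submission
  imports Defs "HOL-Library.Discrete_Functions"
begin

text \<open>
  A node with label \<open>a\<close> and children labelled \<open>b\<close>, \<open>c\<close> can be checked at two moments: when the
  second child is opened (the stream then shows the closing tag of \<open>b\<close> followed by the opening tag
  of \<open>c\<close>), provided \<open>a\<close> is still known, or when the node is closed (the stream then shows \<open>c\<close> and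
  \<open>a\<close>), provided \<open>b\<close> is still known. The labels of the last \<open>K\<close> ancestors are kept in a circular
  buffer, which serves the first kind of check. If \<open>a\<close> has been overwritten, the pair of the depth
  of the node and \<open>b\<close> is pushed on a stack for the second kind of check. This happens only if the
  left subtree has at least \<open>K\<close> nodes; as these subtrees are disjoint for the nodes on the stack
  at any time, the stack has height at most \<open>N div K\<close>. A stack entry costs \<open>O(log N)\<close>, so
  \<open>K\<close> of order \<open>sqrt (N log N)\<close> balances buffer and stack.
\<close>

section \<open>The algorithm on abstract configurations\<close>

text \<open>
  \<open>buf\<close> lists the labels of the closest ancestors that are still known, nearest first, and \<open>peak\<close>
  is the greatest height that the stack \<open>pending\<close> has had so far.
\<close>

record 'a config =
  ok :: bool
  prev :: "'a letter"
  buf :: "'a list"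
  depth :: nat
  pending :: "(nat \<times> 'a) list"
  peak :: nat

text \<open>A closing \<open>prev c\<close> means that \<open>a\<close> is a second child.
  \<open>depth c\<close> counts the open nodes including the parent, a number that recurs when the
  parent is closed.\<close>

definition open_check :: "'a dtd \<Rightarrow> 'a \<Rightarrow> 'a config \<Rightarrow> 'a config" where
  "open_check D a c =
    (case prev c of
       Some (Close b) \<Rightarrow>
         (case buf c of
            [] \<Rightarrow> c\<lparr>pending := (depth c, b) # pending c,
                   peak := max (peak c) (Suc (length (pending c)))\<rparr>
          | x # _ \<Rightarrow> c\<lparr>ok := (ok c \<and> [b, a] \<in> lang (D x))\<rparr>)
     | _ \<Rightarrow> c)"

text \<open>An opening \<open>prev c\<close> signals a leaf. The depth test tells whether the top
  entry belongs to the node being closed or to a proper ancestor.\<close>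

definition close_check :: "'a dtd \<Rightarrow> 'a \<Rightarrow> 'a config \<Rightarrow> 'a config" where
  "close_check D a c =
    (case prev c of
       Some (Close b') \<Rightarrow>
         (case pending c of
            [] \<Rightarrow> c
          | p # ps \<Rightarrow>
              (if fst p = depth c
               then c\<lparr>ok := (ok c \<and> [snd p, b'] \<in> lang (D a)), pending := ps\<rparr> else c))
     | _ \<Rightarrow> c\<lparr>ok := (ok c \<and> [] \<in> lang (D a))\<rparr>)"

fun step :: "'a dtd \<Rightarrow> nat \<Rightarrow> 'a config \<Rightarrow> 'a tag \<Rightarrow> 'a config" where
  "step D K c (Open a) =
     (open_check D a c)\<lparr>prev := Some (Open a), buf := take K (a # buf c), depth := Suc (depth c)\<rparr>"
| "step D K c (Close a) =
     (close_check D a c)\<lparr>prev := Some (Close a), buf := tl (buf c), depth := depth c - 1\<rparr>"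

abbreviation steps :: "'a dtd \<Rightarrow> nat \<Rightarrow> 'a config \<Rightarrow> 'a tag list \<Rightarrow> 'a config" where
  "steps D K \<equiv> foldl (step D K)"

section \<open>Runs of the abstract algorithm over a subtree\<close>

lemma peak_step: "peak c \<le> peak (step D K c x)"
  by (cases x) (auto simp: open_check_def close_check_def split: option.split tag.split list.split)

lemma peak_steps: "peak c \<le> peak (steps D K c w)"
  by (induction w arbitrary: c) (auto intro: order_trans[OF peak_step])

text \<open>
  The bound on \<open>j\<close> says that only a large tree can displace labels from the buffer.
\<close>

lemma steps_tree_tail:
  assumes "binary t" "K > 0" "t = Node a ts"
    and "prev c = Some (Open a)" "buf c = a # xs" "length xs < K"
    and "\<forall>p \<in> set (pending c). fst p < depth c"
  shows "\<exists>j p. steps D K c (tl (xml t)) =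
      c\<lparr>ok := ok c \<and> valid D t, prev := Some (Close a), buf := take j xs, depth := depth c - 1,
        peak := p\<rparr> \<and>
      min (length xs) (K - nodes t) \<le> j \<and> p \<le> max (peak c) (length (pending c) + nodes t div K)"
  using assms
proof (induction t arbitrary: a ts c xs)
  case (Node a' ts')
  then have [simp]: "a' = a" "ts' = ts" by auto
  show ?case
  proof (cases "ts = []")
    case True
    with Node.prems show ?thesis
      by (intro exI[of _ "length xs"] exI[of _ "peak c"]) (simp add: close_check_def)
  next
    case False
    with Node.prems obtain l r where ts: "ts = [l, r]" "binary l" "binary r"
      by (auto simp: length_Suc_conv numeral_2_eq_2)
    obtain b ls where l: "l = Node b ls" by (cases l)
    obtain b' rs where r: "r = Node b' rs" by (cases r)
    have IHl: "\<And>c xs. prev c = Some (Open b) \<Longrightarrow> buf c = b # xs \<Longrightarrow> length xs < K \<Longrightarrow>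
        \<forall>p \<in> set (pending c). fst p < depth c \<Longrightarrow>
        \<exists>j p. steps D K c (tl (xml l)) =
          c\<lparr>ok := ok c \<and> valid D l, prev := Some (Close b), buf := take j xs, depth := depth c - 1,
            peak := p\<rparr> \<and>
          min (length xs) (K - nodes l) \<le> j \<and>
          p \<le> max (peak c) (length (pending c) + nodes l div K)"
      using Node.IH[of l b ls] ts l \<open>K > 0\<close> by simp
    have IHr: "\<And>c xs. prev c = Some (Open b') \<Longrightarrow> buf c = b' # xs \<Longrightarrow> length xs < K \<Longrightarrow>
        \<forall>p \<in> set (pending c). fst p < depth c \<Longrightarrow>
        \<exists>j p. steps D K c (tl (xml r)) =
          c\<lparr>ok := ok c \<and> valid D r, prev := Some (Close b'), buf := take j xs, depth := depth c - 1,
            peak := p\<rparr> \<and>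
          min (length xs) (K - nodes r) \<le> j \<and>
          p \<le> max (peak c) (length (pending c) + nodes r div K)"
      using Node.IH[of r b' rs] ts r \<open>K > 0\<close> by simp
    define c1 where "c1 = step D K c (Open b)"
    have c1: "c1 = c\<lparr>prev := Some (Open b), buf := b # take (K - 1) (a # xs), depth := Suc (depth c)\<rparr>"
      using Node.prems by (simp add: c1_def open_check_def take_Cons')
    have "prev c1 = Some (Open b)" "buf c1 = b # take (K - 1) (a # xs)"
      "length (take (K - 1) (a # xs)) < K" "\<forall>p \<in> set (pending c1). fst p < depth c1"
      using Node.prems by (auto simp: c1)
    from IHl[OF this] obtain j1 p1 where
      2: "steps D K c1 (tl (xml l)) =
          c1\<lparr>ok := ok c1 \<and> valid D l, prev := Some (Close b),
             buf := take j1 (take (K - 1) (a # xs)), depth := depth c1 - 1, peak := p1\<rparr>"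
      and j1: "min (length (take (K - 1) (a # xs))) (K - nodes l) \<le> j1"
      and p1: "p1 \<le> max (peak c1) (length (pending c1) + nodes l div K)"
      by blast
    define c2 where "c2 = steps D K c1 (tl (xml l))"
    have N: "nodes (Node a ts) = Suc (nodes l + nodes r)" using ts by simp
    have xml: "tl (xml (Node a ts)) = Open b # tl (xml l) @ Open b' # tl (xml r) @ [Close a]"
      using ts l r by simp
    have val: "valid D (Node a ts) \<longleftrightarrow> [b, b'] \<in> lang (D a) \<and> valid D l \<and> valid D r"
      using ts l r by simp
    \<comment> \<open>The labels that survive the left subtree; the list is empty exactly when
      \<open>a\<close> has been lost.\<close>
    define ys where "ys = take j1 (take (K - 1) (a # xs))"
    have c2: "c2 = c\<lparr>ok := ok c \<and> valid D l, prev := Some (Close b), buf := ys, peak := p1\<rparr>"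
      unfolding c2_def 2 ys_def by (simp add: c1)
    define zs where "zs = take (K - 1) ys"
    define c3 where "c3 = step D K c2 (Open b')"
    have lenl: "nodes l \<ge> 1" "nodes r \<ge> 1" using l r by simp_all
    have steps: "steps D K c (tl (xml (Node a ts))) = step D K (steps D K c3 (tl (xml r))) (Close a)"
      unfolding xml c3_def c2_def c1_def by simp
    show ?thesis
    proof (cases ys)
      case Nil
      \<comment> \<open>Since \<open>a # xs\<close> is nonempty, \<open>j1 = 0\<close> or
        \<open>K = 1\<close>; in both cases the left subtree has at least \<open>K\<close>
        nodes.\<close>
      have l_ge: "K \<le> nodes l"
        using Nil j1 lenl Node.prems by (auto simp: ys_def min_def split: if_splits)
      \<comment> \<open>The left subtree pays for the new stack entry, the right subtree for
        whatever is pushed above it.\<close>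
      have div: "Suc (nodes r div K) \<le> nodes (Node a ts) div K"
      proof -
        have "Suc (nodes r div K) = (K + nodes r) div K"
          using \<open>K > 0\<close> by simp
        also have "\<dots> \<le> nodes (Node a ts) div K"
          unfolding N using l_ge by (intro div_le_mono) simp
        finally show ?thesis .
      qed
      have divl: "nodes l div K \<le> nodes (Node a ts) div K"
        unfolding N by (intro div_le_mono) simp
      have c3: "c3 = c\<lparr>ok := ok c \<and> valid D l, prev := Some (Open b'), buf := [b'],
          depth := Suc (depth c), pending := (depth c, b) # pending c,
          peak := max p1 (Suc (length (pending c)))\<rparr>"
        using Nil \<open>K > 0\<close> by (simp add: c3_def c2 open_check_def take_Cons')
      have "prev c3 = Some (Open b')" "buf c3 = b' # []" "length ([] :: 'a list) < K"
        "\<forall>p \<in> set (pending c3). fst p < depth c3"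
        using Node.prems by (auto simp: c3)
      from IHr[OF this] obtain j2 p2 where
        4: "steps D K c3 (tl (xml r)) = c3\<lparr>ok := ok c3 \<and> valid D r, prev := Some (Close b'),
              buf := take j2 [], depth := depth c3 - 1, peak := p2\<rparr>"
        and p2: "p2 \<le> max (peak c3) (length (pending c3) + nodes r div K)"
        by blast
      \<comment> \<open>The depth is that of the top entry again, so the postponed check takes place
        at the closing tag and the entry is popped.\<close>
      have "steps D K c (tl (xml (Node a ts))) =
          c\<lparr>ok := ok c \<and> valid D (Node a ts), prev := Some (Close a), buf := take 0 xs,
            depth := depth c - 1, peak := p2\<rparr>"
        unfolding steps 4 unfolding c3 val
        by (intro config.equality) (auto simp: close_check_def)
      moreover have "p2 \<le> max (peak c) (length (pending c) + nodes (Node a ts) div K)"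
        using p2 p1 div divl unfolding c3 c1 by (simp add: le_max_iff_disj) linarith
      moreover have "min (length xs) (K - nodes (Node a ts)) \<le> 0"
        using l_ge unfolding N by simp
      ultimately show ?thesis
        unfolding \<open>a' = a\<close> \<open>ts' = ts\<close> by blast
    next
      case (Cons y ys')
      then have y: "y = a" unfolding ys_def by (auto simp: take_Cons' split: if_splits)
      have divl: "nodes l div K \<le> nodes (Node a ts) div K" "nodes r div K \<le> nodes (Node a ts) div K"
        unfolding N by (intro div_le_mono; simp)+
      have c3: "c3 = c\<lparr>ok := (ok c \<and> valid D l) \<and> [b, b'] \<in> lang (D a), prev := Some (Open b'),
          buf := b' # zs, depth := Suc (depth c), peak := p1\<rparr>"
        using Cons \<open>K > 0\<close> by (simp add: c3_def c2 y open_check_def take_Cons' zs_def)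
      have "prev c3 = Some (Open b')" "buf c3 = b' # zs" "length zs < K"
        "\<forall>p \<in> set (pending c3). fst p < depth c3"
        using Node.prems by (auto simp: c3 zs_def)
      from IHr[OF this] obtain j2 p2 where
        4: "steps D K c3 (tl (xml r)) = c3\<lparr>ok := ok c3 \<and> valid D r, prev := Some (Close b'),
              buf := take j2 zs, depth := depth c3 - 1, peak := p2\<rparr>"
        and j2: "min (length zs) (K - nodes r) \<le> j2"
        and p2: "p2 \<le> max (peak c3) (length (pending c3) + nodes r div K)"
        by blast
      \<comment> \<open>The buffer has been truncated to \<open>K - 1\<close>, \<open>j1\<close> and
        \<open>j2\<close> labels; the closing tag then removes \<open>a\<close> itself, hence the
        \<open>- 1\<close>.\<close>
      define j where "j = min j2 (min j1 (K - 1)) - 1"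
      have "tl (take j2 zs) = take j xs"
        by (simp add: zs_def ys_def j_def tl_take min.commute min.left_commute)
      \<comment> \<open>All pending entries belong to proper ancestors, so the depth test fails and
        nothing is checked twice.\<close>
      moreover have "close_check D a (steps D K c3 (tl (xml r))) = steps D K c3 (tl (xml r))"
        unfolding 4 unfolding c3 using Node.prems(7)
        by (auto simp: close_check_def split: list.split)
      ultimately have "steps D K c (tl (xml (Node a ts))) =
          c\<lparr>ok := ok c \<and> valid D (Node a ts), prev := Some (Close a), buf := take j xs,
            depth := depth c - 1, peak := p2\<rparr>"
        unfolding steps step.simps unfolding 4 unfolding c3 val
        by (intro config.equality) auto
      moreover have "p2 \<le> max (peak c) (length (pending c) + nodes (Node a ts) div K)"
        using p2 p1 divl unfolding c3 c1 by (simp add: le_max_iff_disj) linarith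
      moreover have "min (length xs) (K - nodes (Node a ts)) \<le> j"
      proof (cases "min (length xs) (K - nodes (Node a ts)) = 0")
        case False
        \<comment> \<open>\<open>Suc v\<close> labels have to survive, as \<open>a\<close> precedes
          those of \<open>xs\<close>; the root counted in \<open>nodes (Node a ts)\<close> makes up
          for the extra one.\<close>
        define v where "v = min (length xs) (K - nodes (Node a ts))"
        have v: "Suc v \<le> Suc (length xs)" "Suc v \<le> K - 1" "Suc v \<le> K - nodes l" "Suc v \<le> K - nodes r"
          using False lenl unfolding v_def N by linarith+
        then have "Suc v \<le> j1" using order_trans[OF _ j1, of "Suc v"] by simp
        moreover from this v have "Suc v \<le> j2"
          using order_trans[OF _ j2, of "Suc v"] by (simp add: zs_def ys_def)
        ultimately have "Suc v \<le> min j2 (min j1 (K - 1))" using v by simp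
        then show ?thesis unfolding j_def v_def by linarith
      qed simp
      ultimately show ?thesis
        unfolding \<open>a' = a\<close> \<open>ts' = ts\<close> by blast
    qed
  qed
qed

lemma steps_xml:
  fixes D :: "'a dtd"
  assumes "binary t" "K > 0"
  defines "c \<equiv> steps D K \<lparr>ok = True, prev = None, buf = [], depth = 0, pending = [], peak = 0\<rparr> (xml t)"
  shows "ok c \<longleftrightarrow> valid D t" and "peak c \<le> nodes t div K"
proof -
  obtain a ts where t: "t = Node a ts" by (cases t)
  \<comment> \<open>The inductive lemma starts just after an opening tag, so the tag of the root is
    consumed separately.\<close>
  define c1 :: "'a config"
    where "c1 = \<lparr>ok = True, prev = Some (Open a), buf = [a], depth = 1, pending = [], peak = 0\<rparr>"
  have "step D K \<lparr>ok = True, prev = None, buf = [], depth = 0, pending = [], peak = 0\<rparr> (Open a) = c1"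
    using \<open>K > 0\<close> by (simp add: c1_def open_check_def take_Cons')
  moreover have "xml t = Open a # tl (xml t)"
    unfolding t by simp
  ultimately have c: "c = steps D K c1 (tl (xml t))"
    unfolding c_def by (metis foldl_Cons)
  have "\<exists>j p. steps D K c1 (tl (xml t)) =
      c1\<lparr>ok := ok c1 \<and> valid D t, prev := Some (Close a), buf := take j [], depth := depth c1 - 1,
        peak := p\<rparr> \<and>
      min (length ([] :: 'a list)) (K - nodes t) \<le> j \<and>
      p \<le> max (peak c1) (length (pending c1) + nodes t div K)"
    using \<open>K > 0\<close> by (intro steps_tree_tail[OF assms(1,2) t]) (simp_all add: c1_def)
  then obtain p where "c = c1\<lparr>ok := ok c1 \<and> valid D t, prev := Some (Close a), buf := [],
      depth := depth c1 - 1, peak := p\<rparr>" "p \<le> max (peak c1) (length (pending c1) + nodes t div K)"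
    unfolding c[symmetric] take_Nil by blast
  then show "ok c \<longleftrightarrow> valid D t" "peak c \<le> nodes t div K"
    by (simp_all add: c1_def)
qed

section \<open>Total correctness of programs\<close>

text \<open>By determinism of \<open>exec\<close>, one terminating run ending in \<open>Q\<close>
  amounts to total correctness, absence of overflow included.\<close>

definition wp :: "nat \<Rightarrow> 'a com \<Rightarrow> 'a state \<Rightarrow> ('a state \<Rightarrow> bool) \<Rightarrow> bool" where
  "wp M c s Q \<longleftrightarrow> (\<exists>s'. exec M c s s' \<and> Q s')"

inductive_cases exec_elims:
  "exec M Skip s s'" "exec M (IConst x n) s s'" "exec M (IArith x f y z) s s'"
  "exec M (ILoad x y) s s'" "exec M (IStore x y) s s'" "exec M (LApply x g ys) s s'"
  "exec M (LLoad x y) s s'" "exec M (LStore x y) s s'" "exec M (Read x) s s'"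
  "exec M (Seq c d) s s'" "exec M (Cond b c d) s s'"

lemma wp_simps:
  "wp M Skip s Q \<longleftrightarrow> Q s"
  "wp M (IConst x n) s Q \<longleftrightarrow> n \<le> M \<and> Q (tick (s\<lparr>ireg := (ireg s)(x := n)\<rparr>))"
  "wp M (IArith x f y z) s Q \<longleftrightarrow> arith f (ireg s y) (ireg s z) \<le> M \<and>
     Q (tick (s\<lparr>ireg := (ireg s)(x := arith f (ireg s y) (ireg s z))\<rparr>))"
  "wp M (ILoad x y) s Q \<longleftrightarrow>
     Q (tick (itouch (ireg s y) (s\<lparr>ireg := (ireg s)(x := imem s (ireg s y))\<rparr>)))"
  "wp M (IStore x y) s Q \<longleftrightarrow>
     Q (tick (itouch (ireg s x) (s\<lparr>imem := (imem s)(ireg s x := ireg s y)\<rparr>)))"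
  "wp M (LApply x g ys) s Q \<longleftrightarrow>
     Q (tick (s\<lparr>lreg := (lreg s)(x := g (map (lreg s) ys))\<rparr>))"
  "wp M (LLoad x y) s Q \<longleftrightarrow>
     Q (tick (ltouch (ireg s y) (s\<lparr>lreg := (lreg s)(x := lmem s (ireg s y))\<rparr>)))"
  "wp M (LStore x y) s Q \<longleftrightarrow>
     Q (tick (ltouch (ireg s x) (s\<lparr>lmem := (lmem s)(ireg s x := lreg s y)\<rparr>)))"
  "wp M (Seq c d) s Q \<longleftrightarrow> wp M c s (\<lambda>s'. wp M d s' Q)"
  "wp M (Cond b c d) s Q \<longleftrightarrow> (if holds b s then wp M c (tick s) Q else wp M d (tick s) Q)"
  unfolding wp_def
  by (auto elim!: exec_elims intro: exec.intros) (blast intro: exec.intros elim: exec_elims)?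

lemma wp_Read:
  "stream s = a # w \<Longrightarrow> wp M (Read x) s Q \<longleftrightarrow>
     Q (s\<lparr>stream := w, lreg := (lreg s)(x := Some a), laps := 0 # laps s\<rparr>)"
  unfolding wp_def by (auto elim!: exec_elims intro: exec.intros)

lemma wp_Loop_False: "\<not> holds b s \<Longrightarrow> Q (tick s) \<Longrightarrow> wp M (Loop b c) s Q"
  unfolding wp_def by (blast intro: exec.intros)

lemma wp_Loop_True:
  "holds b s \<Longrightarrow> wp M c (tick s) (\<lambda>s'. wp M (Loop b c) s' Q) \<Longrightarrow> wp M (Loop b c) s Q"
  unfolding wp_def by (blast intro: exec.intros)

lemma wp_mono: "wp M c s Q \<Longrightarrow> (\<And>s'. Q s' \<Longrightarrow> Q' s') \<Longrightarrow> wp M c s Q'"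
  unfolding wp_def by blast

section \<open>The validator\<close>

fun is_open :: "'a letter list \<Rightarrow> bool" where
  "is_open [Some (Open _)] \<longleftrightarrow> True"
| "is_open _ \<longleftrightarrow> False"

fun is_close :: "'a letter list \<Rightarrow> bool" where
  "is_close [Some (Close _)] \<longleftrightarrow> True"
| "is_close _ \<longleftrightarrow> False"

fun the_label :: "'a letter \<Rightarrow> 'a" where
  "the_label (Some (Open a)) = a"
| "the_label (Some (Close a)) = a"
| "the_label None = undefined"

text \<open>The parent comes first. Its tag is an opening one if it stems from the buffer and a
  closing one if it is the current tag, so only labels are used.\<close>

fun conforms :: "'a dtd \<Rightarrow> 'a letter list \<Rightarrow> bool" where
  "conforms D (x # ys) \<longleftrightarrow> map the_label ys \<in> lang (D (the_label x))"
| "conforms D [] \<longleftrightarrow> False"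

text \<open>
  Integer registers: 0 answer, 1 number of unread tags, 2 depth, 3 length of \<open>buf\<close>, 4 height of the
  stack, 5 \<open>K\<close>, 6 constant 1, 7 scratch. Letter registers: 0 current tag, 1 previous tag, 2 scratch.
  The label of the open node at depth \<open>d\<close> is kept in letter cell \<open>d mod K\<close>; the \<open>i\<close>-th stack entry
  (from 1) consists of integer cell \<open>i\<close> and letter cell \<open>K + i\<close>.
\<close>

notation Seq (infixr ";;" 60)

text \<open>A failed check clears register 0, and no later check sets it again.\<close>

definition check :: "'a dtd \<Rightarrow> nat list \<Rightarrow> 'a com" where
  "check D xs = Cond (Letters (conforms D) xs) Skip (IConst 0 0)"

definition open_com :: "'a dtd \<Rightarrow> 'a com" where
  "open_com D =
     Cond (Letters is_close [1])
       (Cond (Leq 6 3)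
          (IArith 7 Minus 2 6;; IArith 7 Mod 7 5;; LLoad 2 7;; check D [2, 1, 0])
          (IArith 4 Plus 4 6;; IStore 4 2;; IArith 7 Plus 5 4;; LStore 7 1))
       Skip"

definition push_com :: "'a com" where
  "push_com =
     IArith 7 Mod 2 5;; LStore 7 0;; IArith 2 Plus 2 6;;
     Cond (Leq 5 3) Skip (IArith 3 Plus 3 6)"

text \<open>Two nested \<open>Leq\<close> tests express equality of depths. In
  \<open>[0, 2, 1]\<close> the parent is the current tag, the left child comes from the stack and
  the right child is the previous tag.\<close>

definition close_com :: "'a dtd \<Rightarrow> 'a com" where
  "close_com D =
     Cond (Letters is_close [1])
       (Cond (Leq 6 4)
          (ILoad 7 4;;
           Cond (Leq 2 7)
             (Cond (Leq 7 2)
                (IArith 7 Plus 5 4;; LLoad 2 7;; check D [0, 2, 1];; IArith 4 Minus 4 6)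
                Skip)
             Skip)
          Skip)
       (check D [0])"

definition pop_com :: "'a com" where
  "pop_com = IArith 2 Minus 2 6;; IArith 3 Minus 3 6"

definition body :: "'a dtd \<Rightarrow> 'a com" where
  "body D =
     Read 0;; IArith 1 Minus 1 6;;
     Cond (Letters is_open [0]) (open_com D;; push_com) (close_com D;; pop_com);;
     LApply 1 hd [0]"

section \<open>Representation of configurations in memory\<close>

definition buf_at :: "nat \<Rightarrow> (nat \<Rightarrow> 'a letter) \<Rightarrow> nat \<Rightarrow> 'a list \<Rightarrow> bool" where
  "buf_at K lm d xs \<longleftrightarrow> length xs \<le> K \<and> length xs \<le> d \<and>
     (\<forall>i < length xs. lm ((d - Suc i) mod K) = Some (Open (xs ! i)))"

fun stack_at :: "nat \<Rightarrow> (nat \<Rightarrow> nat) \<Rightarrow> (nat \<Rightarrow> 'a letter) \<Rightarrow> (nat \<times> 'a) list \<Rightarrow> bool" where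
  "stack_at K im lm [] \<longleftrightarrow> True"
| "stack_at K im lm (p # ps) \<longleftrightarrow>
     im (Suc (length ps)) = fst p \<and> lm (K + Suc (length ps)) = Some (Close (snd p)) \<and>
     stack_at K im lm ps"

lemma mod_neq_of_less:
  fixes d i K :: nat
  assumes "0 < i" "i < K" "i \<le> d"
  shows "(d - i) mod K \<noteq> d mod K"
proof
  assume "(d - i) mod K = d mod K"
  then have "K dvd d - (d - i)" by (metis diff_le_self mod_eq_dvd_iff_nat)
  with assms show False by (simp add: nat_dvd_not_less)
qed

text \<open>If the buffer is full, cell \<open>d mod K\<close> holds the label at distance
  \<open>K\<close>, which \<open>take K\<close> drops. The other labels lie at smaller distances,
  hence in other cells.\<close>

lemma buf_at_push:
  assumes "buf_at K lm d xs" "K > 0"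
  shows "buf_at K (lm(d mod K := Some (Open a))) (Suc d) (take K (a # xs))"
  unfolding buf_at_def
proof (intro conjI allI impI)
  have "length xs \<le> d" and lm: "\<And>i. i < length xs \<Longrightarrow> lm ((d - Suc i) mod K) = Some (Open (xs ! i))"
    using assms(1) by (simp_all add: buf_at_def)
  then show "length (take K (a # xs)) \<le> Suc d" by simp
  fix i assume i: "i < length (take K (a # xs))"
  show "(lm(d mod K := Some (Open a))) ((Suc d - Suc i) mod K) = Some (Open (take K (a # xs) ! i))"
  proof (cases i)
    case (Suc k)
    with i have k: "k < length xs" "i < K" by simp_all
    then have "(d - i) mod K \<noteq> d mod K"
      using Suc \<open>length xs \<le> d\<close> by (intro mod_neq_of_less) simp_all
    then show ?thesis using lm[OF k(1)] Suc k by simp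
  qed (use \<open>K > 0\<close> in simp)
qed simp

lemma buf_at_pop: "buf_at K lm d xs \<Longrightarrow> buf_at K lm (d - 1) (tl xs)"
  by (auto simp: buf_at_def nth_tl)

text \<open>The buffer occupies letter cells below \<open>K\<close> and the stack cells above, so
  writing to one leaves the other intact.\<close>

lemma buf_at_beyond [simp]:
  assumes "K > 0" "K \<le> j"
  shows "buf_at K (lm(j := x)) d xs = buf_at K lm d xs"
proof -
  have "m mod K \<noteq> j" for m
    using mod_less_divisor[of K m] assms by linarith
  then show ?thesis by (simp add: buf_at_def)
qed

lemma stack_at_beyond [simp]:
  "length ps < i \<Longrightarrow> stack_at K (im(i := x)) lm ps = stack_at K im lm ps"
  "K + length ps < j \<Longrightarrow> stack_at K im (lm(j := y)) ps = stack_at K im lm ps"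
  "j < K \<Longrightarrow> stack_at K im (lm(j := y)) ps = stack_at K im lm ps"
  by (induction ps) auto

text \<open>Space is bounded through \<open>peak\<close> because touched cells stay charged after a
  pop. The sum of depth and unread tags never grows, which keeps the depth register within
  \<open>M\<close>.\<close>

definition represents :: "nat \<Rightarrow> nat \<Rightarrow> 'a config \<Rightarrow> 'a state \<Rightarrow> bool" where
  "represents M K c s \<longleftrightarrow>
     ireg s 0 = of_bool (ok c) \<and> ireg s 1 = length (stream s) \<and> ireg s 2 = depth c \<and>
     ireg s 3 = length (buf c) \<and> ireg s 4 = length (pending c) \<and> ireg s 5 = K \<and> ireg s 6 = 1 \<and>
     lreg s 1 = prev c \<and> buf_at K (lmem s) (depth c) (buf c) \<and>
     stack_at K (imem s) (lmem s) (pending c) \<and>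
     depth c + length (stream s) \<le> M \<and> length (pending c) \<le> peak c \<and>
     icells s \<le> Suc (peak c) \<and> lcells s \<le> Suc (K + peak c)"

section \<open>Verification of the loop body and the main loop\<close>

lemma is_close_iff: "is_close [x] \<longleftrightarrow> (\<exists>b. x = Some (Close b))"
  by (cases "[x]" rule: is_close.cases) auto

text \<open>Describes a program part without reads: only the current lap grows, by at most
  \<open>k\<close>.\<close>

definition same_input :: "nat \<Rightarrow> 'a state \<Rightarrow> 'a state \<Rightarrow> bool" where
  "same_input k s s' \<longleftrightarrow> stream s' = stream s \<and> lreg s' 0 = lreg s 0 \<and>
     (\<exists>n \<le> hd (laps s) + k. laps s' = n # tl (laps s))"

lemmas resource_defs = tick_def itouch_def ltouch_def

text \<open>The assumption on \<open>peak\<close> is there because the address \<open>K + i\<close>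
  of a stack entry has to be an integer of the machine.\<close>

lemma wp_open_com:
  assumes R: "represents M K c s" and x: "lreg s 0 = Some (Open a)"
    and K: "0 < K" and peak: "K + peak (open_check D a c) \<le> M"
  shows "wp M (open_com D) s (\<lambda>s'. represents M K (open_check D a c) s' \<and> same_input 10 s s')"
proof (cases "is_close [prev c]")
  case False
  then have oc: "open_check D a c = c"
    by (auto simp: open_check_def split: option.split tag.split)
  show ?thesis
    using R False unfolding represents_def
    by (simp add: open_com_def resource_defs wp_simps oc same_input_def)
next
  case True
  then obtain b where b: "prev c = Some (Close b)" by (auto simp: is_close_iff)
  show ?thesis
  proof (cases "buf c")
    case (Cons y ys)
    then have oc: "open_check D a c = c\<lparr>ok := ok c \<and> [b, a] \<in> lang (D y)\<rparr>"
      by (simp add: open_check_def b)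
    have top: "lmem s ((depth c - Suc 0) mod K) = Some (Open y)"
      using R Cons by (auto simp: represents_def buf_at_def)
    define i where "i = (depth c - Suc 0) mod K"
    have i: "i < K" "i \<le> M" "i \<le> K + peak c"
      using K peak mod_less_divisor[of K "depth c - Suc 0"] unfolding i_def oc by (simp_all, linarith+)
    have "depth c - Suc 0 \<le> M" using R unfolding represents_def by linarith
    then show ?thesis
      using R x b Cons i top peak unfolding represents_def i_def[symmetric]
      by (simp add: open_com_def check_def resource_defs wp_simps oc same_input_def i_def[symmetric])
  next
    case Nil
    then have oc: "open_check D a c = c\<lparr>pending := (depth c, b) # pending c,
               peak := max (peak c) (Suc (length (pending c)))\<rparr>"
      by (simp add: open_check_def b)
    have "K + Suc (length (pending c)) \<le> M" using peak by (simp add: oc)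
    then show ?thesis
      using R x b Nil K unfolding represents_def
      by (simp add: open_com_def resource_defs wp_simps oc same_input_def) linarith
  qed
qed

lemma wp_push_com:
  assumes R: "represents M K c s" and x: "lreg s 0 = Some (Open a)"
    and K: "0 < K" "K \<le> M" and d: "depth c + length (stream s) < M"
  shows "wp M push_com s (\<lambda>s'.
      represents M K (c\<lparr>buf := take K (a # buf c), depth := Suc (depth c)\<rparr>) s' \<and> same_input 10 s s')"
proof -
  from R have B: "buf_at K (lmem s) (depth c) (buf c)"
    by (simp add: represents_def)
  then have len: "length (buf c) \<le> K"
    by (simp add: buf_at_def)
  define i where "i = depth c mod K"
  have push: "buf_at K ((lmem s)(i \<mapsto> Open a)) (Suc (depth c)) (take K (a # buf c))"
    unfolding i_def by (rule buf_at_push[OF B \<open>0 < K\<close>])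
  have i: "i < K" "i \<le> M" "i \<le> K + peak c"
    using K mod_less_divisor[of K "depth c"] unfolding i_def by (simp_all, linarith+)
  show ?thesis
  proof (cases "K \<le> length (buf c)")
    case True
    with len have "length (buf c) = K" by simp
    then show ?thesis
      using R x i push K d unfolding represents_def
      by (simp add: push_com_def resource_defs wp_simps same_input_def i_def[symmetric])
  next
    case False
    then show ?thesis
      using R x i push K d unfolding represents_def
      by (simp add: push_com_def resource_defs wp_simps same_input_def i_def[symmetric])
  qed
qed

text \<open>The slowest of the four parts: a failed check of a pending node takes exactly 10 ticks,
  the bound used for all of them.\<close>

lemma wp_close_com:
  assumes R: "represents M K c s" and x: "lreg s 0 = Some (Close a)"
    and K: "K + peak c \<le> M"
  shows "wp M (close_com D) s (\<lambda>s'. represents M K (close_check D a c) s' \<and> same_input 10 s s')"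
proof (cases "is_close [prev c]")
  case False
  then have cc: "close_check D a c = c\<lparr>ok := ok c \<and> [] \<in> lang (D a)\<rparr>"
    by (auto simp: close_check_def split: option.split tag.split)
  show ?thesis
    using R x False unfolding represents_def
    by (simp add: close_com_def check_def resource_defs wp_simps cc same_input_def)
next
  case True
  then obtain b where b: "prev c = Some (Close b)" by (auto simp: is_close_iff)
  show ?thesis
  proof (cases "pending c")
    case Nil
    then have cc: "close_check D a c = c"
      by (simp add: close_check_def b)
    show ?thesis
      using R x b Nil unfolding represents_def
      by (simp add: close_com_def check_def resource_defs wp_simps cc same_input_def)
  next
    case (Cons p ps)
    show ?thesis
    proof (cases "fst p = depth c")
      case True
      then have cc: "close_check D a c = c\<lparr>ok := ok c \<and> [snd p, b] \<in> lang (D a), pending := ps\<rparr>"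
        by (simp add: close_check_def b Cons)
      show ?thesis
        using R x b Cons True K unfolding represents_def
        by (simp add: close_com_def check_def resource_defs wp_simps cc same_input_def)
    next
      case False
      then have cc: "close_check D a c = c"
        by (simp add: close_check_def b Cons)
      show ?thesis
        using R x b Cons False unfolding represents_def
        by (simp add: close_com_def check_def resource_defs wp_simps cc same_input_def)
    qed
  qed
qed

lemma wp_pop_com:
  assumes R: "represents M K c s" and M: "K \<le> M"
  shows "wp M pop_com s (\<lambda>s'.
      represents M K (c\<lparr>buf := tl (buf c), depth := depth c - 1\<rparr>) s' \<and> same_input 10 s s')"
proof -
  from R have B: "buf_at K (lmem s) (depth c) (buf c)"
    by (simp add: represents_def)
  then have len: "length (buf c) \<le> K"
    by (simp add: buf_at_def)
  show ?thesis
    using R len M buf_at_pop[OF B] unfolding represents_def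
    by (simp add: pop_com_def resource_defs wp_simps same_input_def) linarith
qed

lemma represents_tick [simp]: "represents M K c (tick s) = represents M K c s"
  by (simp add: represents_def tick_def)

lemma same_input_trans: "same_input k s s' \<Longrightarrow> same_input l s' s'' \<Longrightarrow> same_input (k + l) s s''"
  by (fastforce simp: same_input_def)

lemma open_check_simps [simp]:
  "depth (open_check D a c) = depth c" "buf (open_check D a c) = buf c"
  by (simp_all add: open_check_def split: option.split tag.split list.split)

lemma close_check_simps [simp]:
  "depth (close_check D a c) = depth c" "buf (close_check D a c) = buf c"
  "peak (close_check D a c) = peak c"
  by (simp_all add: close_check_def split: option.split tag.split list.split)

lemma wp_body:
  assumes R: "represents M K c s" and w: "stream s = x # w"
    and K: "0 < K" and peak: "K + peak (step D K c x) \<le> M"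
  shows "wp M (body D) s (\<lambda>s'. represents M K (step D K c x) s' \<and> stream s' = w \<and>
           (\<exists>n \<le> 30. laps s' = n # laps s))"
proof -
  \<comment> \<open>The state after the read, the decrement of register 1 and the test of the tag;
    the latter two account for 2 ticks.\<close>
  define s2 where "s2 = tick (tick (s\<lparr>stream := w, lreg := (lreg s)(0 := Some x), laps := 0 # laps s,
      ireg := (ireg s)(1 := length w)\<rparr>))"
  have R2: "represents M K c s2"
    using R w by (simp add: s2_def tick_def represents_def)
  have d: "depth c + length w < M"
    using R w by (simp add: represents_def)
  have s2: "stream s2 = w" "lreg s2 0 = Some x" "laps s2 = 2 # laps s"
    by (simp_all add: s2_def tick_def)
  \<comment> \<open>The final \<open>LApply\<close> makes the current tag the previous one;
    \<open>2 + 20 + 1\<close> ticks stay below 30.\<close>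
  have last: "represents M K (step D K c x) s'' \<and> stream s'' = w \<and> (\<exists>n \<le> 30. laps s'' = n # laps s)"
    if "represents M K c' s'" "same_input 20 s2 s'" "step D K c x = c'\<lparr>prev := Some x\<rparr>"
      and s'': "s'' = tick (s'\<lparr>lreg := (lreg s')(Suc 0 := lreg s' 0)\<rparr>)" for s' s'' c'
    using that s2 unfolding same_input_def represents_def
    by (auto simp: tick_def)
  have KM: "K \<le> M" using peak by simp
  have main: "wp M (if is_open [Some x] then open_com D;; push_com else close_com D;; pop_com) s2
      (\<lambda>s'. \<exists>c'. represents M K c' s' \<and> same_input 20 s2 s' \<and> step D K c x = c'\<lparr>prev := Some x\<rparr>)"
  proof (cases x)
    case x: (Open a)
    have 1: "wp M (open_com D) s2 (\<lambda>s'. represents M K (open_check D a c) s' \<and> same_input 10 s2 s')"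
      using R2 s2 K peak unfolding x by (intro wp_open_com) simp_all
    have "wp M (open_com D) s2 (\<lambda>s'. wp M push_com s'
        (\<lambda>s''. \<exists>c'. represents M K c' s'' \<and> same_input 20 s2 s'' \<and> step D K c x = c'\<lparr>prev := Some x\<rparr>))"
    proof (rule wp_mono[OF 1], elim conjE)
      fix s' assume R': "represents M K (open_check D a c) s'" and i: "same_input 10 s2 s'"
      then have "lreg s' 0 = Some (Open a)" "depth (open_check D a c) + length (stream s') < M"
        using s2 d x by (simp_all add: same_input_def)
      from wp_push_com[OF R' this(1) K KM this(2)]
      show "wp M push_com s' (\<lambda>s''. \<exists>c'. represents M K c' s'' \<and> same_input 20 s2 s'' \<and>
          step D K c x = c'\<lparr>prev := Some x\<rparr>)"
        by (rule wp_mono) (use same_input_trans[OF i, of 10] x in \<open>auto intro!: exI\<close>)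
    qed
    then show ?thesis by (simp add: x wp_simps)
  next
    case x: (Close a)
    have 1: "wp M (close_com D) s2 (\<lambda>s'. represents M K (close_check D a c) s' \<and> same_input 10 s2 s')"
      using R2 s2 peak unfolding x by (intro wp_close_com) simp_all
    have "wp M (close_com D) s2 (\<lambda>s'. wp M pop_com s'
        (\<lambda>s''. \<exists>c'. represents M K c' s'' \<and> same_input 20 s2 s'' \<and> step D K c x = c'\<lparr>prev := Some x\<rparr>))"
    proof (rule wp_mono[OF 1], elim conjE)
      fix s' assume R': "represents M K (close_check D a c) s'" and i: "same_input 10 s2 s'"
      from wp_pop_com[OF R' KM]
      show "wp M pop_com s' (\<lambda>s''. \<exists>c'. represents M K c' s'' \<and> same_input 20 s2 s'' \<and>
          step D K c x = c'\<lparr>prev := Some x\<rparr>)"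
        by (rule wp_mono) (use same_input_trans[OF i, of 10] x in \<open>auto intro!: exI\<close>)
    qed
    then show ?thesis by (simp add: x wp_simps)
  qed
  have r: "ireg s 1 = Suc (length w)" "ireg s 6 = 1" "length w \<le> M"
    using R w by (simp_all add: represents_def)
  have "wp M (if is_open [Some x] then open_com D;; push_com else close_com D;; pop_com) s2
      (\<lambda>s'. wp M (LApply 1 hd [0]) s' (\<lambda>s''. represents M K (step D K c x) s'' \<and> stream s'' = w \<and>
           (\<exists>n \<le> 30. laps s'' = n # laps s)))"
  proof (rule wp_mono[OF main], elim exE conjE)
    fix s' c' assume "represents M K c' s'" "same_input 20 s2 s'" "step D K c x = c'\<lparr>prev := Some x\<rparr>"
    from last[OF this refl] show "wp M (LApply 1 hd [0]) s' (\<lambda>s''. represents M K (step D K c x) s'' \<and>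
        stream s'' = w \<and> (\<exists>n \<le> 30. laps s'' = n # laps s))"
      by (simp add: wp_simps)
  qed
  moreover have "tick (tick (s\<lparr>stream := w, lreg := (lreg s)(0 := Some x), laps := 0 # laps s,
      ireg := (ireg s)(1 := length w)\<rparr>)) = s2" by (simp add: s2_def)
  ultimately show ?thesis
    using r by (simp add: body_def wp_simps wp_Read[OF w] tick_def split: if_splits)
qed

text \<open>At the loop head the current lap keeps one tick in reserve for the next loop test.
  \<open>butlast\<close> discards the time before the first read.\<close>

definition timely :: "nat \<Rightarrow> 'a state \<Rightarrow> bool" where
  "timely B s \<longleftrightarrow> laps s \<noteq> [] \<and> (\<forall>n \<in> set (butlast (laps s)). n \<le> Suc B) \<and>
     (length (laps s) > 1 \<longrightarrow> hd (laps s) \<le> B)"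

lemma wp_main_loop:
  assumes "represents M K c s" "timely 30 s" "0 < K" "K + peak (steps D K c (stream s)) \<le> M"
  shows "wp M (Loop (Leq 6 1) (body D)) s (\<lambda>s'. represents M K (steps D K c (stream s)) s' \<and>
           (\<forall>n \<in> set (butlast (laps s')). n \<le> 31))"
  using assms
proof (induction "stream s" arbitrary: c s)
  case Nil
  have "\<not> holds (Leq 6 1) s"
    using Nil by (simp add: represents_def)
  moreover have "\<forall>n \<in> set (butlast (laps (tick s))). n \<le> 31"
    using \<open>timely 30 s\<close> by (cases "laps s") (auto simp: tick_def timely_def split: if_splits)
  ultimately show ?case
    using Nil(1)[symmetric] Nil(2) by (intro wp_Loop_False) auto
next
  case (Cons x w)
  \<comment> \<open>\<open>peak\<close> never decreases, so its bound at the end of the run covers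
    every step.\<close>
  have peak: "K + peak (step D K c x) \<le> M"
    using Cons(6) Cons(2)[symmetric] peak_steps[of "step D K c x" D K w] by simp
  have "stream (tick s) = x # w" using Cons(2) by (simp add: tick_def)
  from wp_body[OF _ this Cons(5) peak] Cons(3)
  have 1: "wp M (body D) (tick s) (\<lambda>s'. represents M K (step D K c x) s' \<and> stream s' = w \<and>
           (\<exists>n \<le> 30. laps s' = n # laps (tick s)))" by simp
  show ?case
  proof (rule wp_Loop_True)
    show "holds (Leq 6 1) s" using Cons(2,3) by (simp add: represents_def Cons(2)[symmetric])
    show "wp M (body D) (tick s) (\<lambda>s'. wp M (Loop (Leq 6 1) (body D)) s'
        (\<lambda>s'. represents M K (steps D K c (stream s)) s' \<and> (\<forall>n \<in> set (butlast (laps s')). n \<le> 31)))"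
    proof (rule wp_mono[OF 1], elim conjE exE)
      fix s' n
      assume s': "represents M K (step D K c x) s'" "stream s' = w" "n \<le> 30" "laps s' = n # laps (tick s)"
      have "timely 30 s'"
        using Cons(4) s' by (cases "laps s") (auto simp: timely_def tick_def split: if_splits)
      from Cons(1)[OF s'(2)[symmetric] s'(1) this Cons(5)]
      show "wp M (Loop (Leq 6 1) (body D)) s'
        (\<lambda>s'. represents M K (steps D K c (stream s)) s' \<and> (\<forall>n \<in> set (butlast (laps s')). n \<le> 31))"
        using Cons(6) s'(2) by (simp add: Cons(2)[symmetric])
    qed
  qed
qed

section \<open>Choice of the buffer size\<close>

text \<open>
  Computes \<open>K = width M\<close> in register 5 by means of the bit length of \<open>M\<close> (register 8, by repeated
  halving) and an integer square root. The test for the latter compares \<open>q + 1\<close> with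
  \<open>X div (q + 1)\<close> because \<open>(q + 1)\<^sup>2\<close> may exceed \<open>M\<close>. Registers 4 and 8 initially hold 0, so that
  adding them copies a register.
\<close>

definition sqrt_com :: "'a com" where
  "sqrt_com =
     IArith 7 Div 0 8;; IConst 5 1;; IConst 10 2;; IArith 11 Div 7 10;;
     Loop (Leq 10 11) (IArith 5 Plus 10 4;; IArith 10 Plus 10 6;; IArith 11 Div 7 10);;
     IArith 5 Times 5 8;; IConst 0 1"

definition setup_com :: "'a com" where
  "setup_com =
     IConst 6 1;; IConst 9 2;; IArith 1 Plus 0 8;; IArith 7 Plus 0 8;;
     Loop (Leq 6 7) (IArith 7 Div 7 9;; IArith 8 Plus 8 6);; sqrt_com"

definition validator :: "'a dtd \<Rightarrow> 'a com" where
  "validator D = setup_com;; Loop (Leq 6 1) (body D)"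

text \<open>Approximates \<open>sqrt (M * L)\<close> with \<open>L = ceillog2 (M + 1)\<close>. The
  root is taken of \<open>M div L\<close> because \<open>M * L\<close> may exceed the integer
  range.\<close>

definition width :: "nat \<Rightarrow> nat" where
  "width M = floor_sqrt (M div ceillog2 (M + 1)) * ceillog2 (M + 1)"

text \<open>Invariant of both initialisation loops. Memory contents are left open, since an empty
  buffer and an empty stack constrain no cell.\<close>

definition starting :: "'a tag list \<Rightarrow> 'a state \<Rightarrow> bool" where
  "starting w s \<longleftrightarrow> stream s = w \<and> lreg s = (\<lambda>_. None) \<and> icells s = 0 \<and> lcells s = 0 \<and>
     (\<exists>n. laps s = [n]) \<and> ireg s 0 = length w \<and> ireg s 1 = length w \<and> ireg s 2 = 0 \<and>
     ireg s 3 = 0 \<and> ireg s 4 = 0 \<and> ireg s 6 = 1"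

section \<open>Verification of the initialisation\<close>

lemma ceillog2_Suc_rec: "0 < n \<Longrightarrow> ceillog2 (Suc n) = Suc (ceillog2 (Suc (n div 2)))"
  by (subst ceillog2_rec) simp

lemma ceillog2_Suc_le: "ceillog2 (Suc n) \<le> n"
  by (simp add: ceillog2_le_iff Suc_le_eq less_exp)

lemma ceillog2_Suc_pos: "0 < n \<Longrightarrow> 0 < ceillog2 (Suc n)"
  by (simp add: ceillog2_Suc_rec)

text \<open>Halving a positive register 7 lowers its bit length by one, so the sum of that length
  and register 8 is invariant.\<close>

lemma wp_log_loop:
  assumes "starting w s" "ireg s 9 = 2" "ireg s 7 \<le> M" "ireg s 8 + ceillog2 (Suc (ireg s 7)) \<le> M"
  shows "wp M (Loop (Leq 6 7) (IArith 7 Div 7 9;; IArith 8 Plus 8 6)) s (\<lambda>s'. starting w s' \<and>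
           ireg s' 8 = ireg s 8 + ceillog2 (Suc (ireg s 7)))"
  using assms
proof (induction "ireg s 7" arbitrary: s rule: less_induct)
  case less
  show ?case
  proof (cases "ireg s 7 = 0")
    case True
    then show ?thesis
      using less.prems by (intro wp_Loop_False) (auto simp: starting_def tick_def)
  next
    case False
    define s1 where "s1 = tick (tick (tick (s\<lparr>ireg := (ireg s)(7 := ireg s 7 div 2,
      8 := Suc (ireg s 8))\<rparr>)))"
    have rec: "ceillog2 (Suc (ireg s 7)) = Suc (ceillog2 (Suc (ireg s 7 div 2)))"
      using False by (intro ceillog2_Suc_rec) simp
    have s1: "starting w s1" "ireg s1 9 = 2" "ireg s1 7 = ireg s 7 div 2" "ireg s1 8 = Suc (ireg s 8)"
      using less.prems by (auto simp: s1_def tick_def starting_def)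
    have "wp M (Loop (Leq 6 7) (IArith 7 Div 7 9;; IArith 8 Plus 8 6)) s1 (\<lambda>s'. starting w s' \<and>
           ireg s' 8 = ireg s1 8 + ceillog2 (Suc (ireg s1 7)))"
      using s1 False less.prems rec by (intro less.hyps) (auto intro: order_trans[OF div_le_dividend])
    moreover have "ireg s 7 div 2 \<le> M" "Suc (ireg s 8) \<le> M"
      using less.prems rec by (auto intro: order_trans[OF div_le_dividend])
    ultimately show ?thesis
      using less.prems False rec unfolding s1(3,4)
      by (intro wp_Loop_True) (auto simp: starting_def wp_simps tick_def s1_def)
  qed
qed

text \<open>Register 5 approximates the root from below by some \<open>q\<close>;
  \<open>X < M\<close> leaves room for \<open>q + 2\<close> in register 10.\<close>

lemma wp_sqrt_loop:
  assumes "starting w s" "ireg s 7 = X" "ireg s 10 = Suc (ireg s 5)" "ireg s 11 = X div Suc (ireg s 5)"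
    and "0 < ireg s 5" "(ireg s 5)\<^sup>2 \<le> X" "X < M"
  shows "wp M (Loop (Leq 10 11) (IArith 5 Plus 10 4;; IArith 10 Plus 10 6;; IArith 11 Div 7 10)) s
           (\<lambda>s'. starting w s' \<and> ireg s' 8 = ireg s 8 \<and> ireg s' 5 = floor_sqrt X)"
  using assms
proof (induction "X - ireg s 5" arbitrary: s rule: less_induct)
  case less
  define q where "q = ireg s 5"
  have iff: "Suc q \<le> X div Suc q \<longleftrightarrow> (Suc q)\<^sup>2 \<le> X"
    by (simp add: less_eq_div_iff_mult_less_eq power2_eq_square)
  show ?case
  proof (cases "Suc q \<le> X div Suc q")
    case False
    then have "floor_sqrt X = q"
      using iff less.prems by (intro floor_sqrt_unique) (auto simp: q_def)
    then show ?thesis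
      using less.prems False
      by (intro wp_Loop_False) (auto simp: starting_def tick_def q_def)
  next
    case True
    define s1 where "s1 = tick (tick (tick (tick (s\<lparr>ireg := (ireg s)(5 := Suc q, 10 := Suc (Suc q),
        11 := X div Suc (Suc q))\<rparr>))))"
    have q: "Suc q < M" "Suc q \<le> X"
      using True iff less.prems(7) self_le_power[of "Suc q" 2] by auto
    have s1: "starting w s1" "ireg s1 7 = X" "ireg s1 10 = Suc (Suc q)" "ireg s1 5 = Suc q"
      "ireg s1 11 = X div Suc (Suc q)" "ireg s1 8 = ireg s 8"
      using less.prems by (auto simp: s1_def tick_def starting_def)
    have "wp M (Loop (Leq 10 11) (IArith 5 Plus 10 4;; IArith 10 Plus 10 6;; IArith 11 Div 7 10)) s1
           (\<lambda>s'. starting w s' \<and> ireg s' 8 = ireg s1 8 \<and> ireg s' 5 = floor_sqrt X)"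
      using s1 True iff less.prems q by (intro less.hyps) (auto simp: q_def)
    moreover have "X div Suc (Suc q) \<le> M"
      using less.prems(7) div_le_dividend[of X "Suc (Suc q)"] by linarith
    ultimately show ?thesis
      using less.prems True q unfolding s1(6)
      by (intro wp_Loop_True) (auto simp: starting_def wp_simps tick_def s1_def q_def)
  qed
qed

lemma width_pos: "0 < M \<Longrightarrow> 0 < width M" and width_le: "width M \<le> M"
proof -
  define L where "L = ceillog2 (M + 1)"
  have "floor_sqrt (M div L) * L \<le> M div L * L"
    by (intro mult_right_mono floor_sqrt_le) simp
  also have "\<dots> \<le> M" by simp
  finally show "width M \<le> M" by (simp add: width_def L_def)
  assume "0 < M"
  then have "0 < L" "L \<le> M"
    using ceillog2_Suc_pos[of M] ceillog2_Suc_le[of M] by (simp_all add: L_def)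
  then show "0 < width M" unfolding width_def L_def[symmetric] by (simp add: div_greater_zero_iff)
qed

lemma wp_setup:
  assumes M: "M = length w" "2 \<le> M"
  shows "wp M setup_com (init w) (\<lambda>s. timely B s \<and> stream s = w \<and> represents M (width M)
           \<lparr>ok = True, prev = None, buf = [], depth = 0, pending = [], peak = 0\<rparr> s)"
proof -
  define L where "L = ceillog2 (Suc M)"
  define X where "X = M div L"
  have L: "0 < L" "L \<le> M"
    using ceillog2_Suc_pos[of M] ceillog2_Suc_le[of M] \<open>2 \<le> M\<close> unfolding L_def by linarith+
  \<comment> \<open>This makes \<open>X\<close> smaller than \<open>M\<close>, as the square root
    loop requires.\<close>
  have "2 \<le> L"
    unfolding L_def using M ceillog2_mono[of 3 "Suc M"] by (simp add: ceillog2_rec)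
  then have X: "0 < X" "X < M"
    using L \<open>2 \<le> M\<close> div_less_dividend[of L M] unfolding X_def
    by (simp_all add: div_greater_zero_iff)
  define s0 where "s0 = tick (tick (tick (tick ((init w)\<lparr>ireg :=
    (\<lambda>_. 0)(0 := M, 6 := 1, 9 := 2, 1 := M, 7 := M)\<rparr>))))"
  have "starting w s0" "ireg s0 9 = 2" "ireg s0 7 = M" "ireg s0 8 = 0"
    by (auto simp: s0_def starting_def tick_def init_def M)
  with L have "wp M (Loop (Leq 6 7) (IArith 7 Div 7 9;; IArith 8 Plus 8 6)) s0 (\<lambda>s'. starting w s' \<and>
           ireg s' 8 = L)"
    using wp_log_loop[of w s0 M] by (simp add: L_def)
  moreover have "wp M sqrt_com s (\<lambda>s. timely B s \<and> stream s = w \<and> represents M (width M)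
           \<lparr>ok = True, prev = None, buf = [], depth = 0, pending = [], peak = 0\<rparr> s)"
    if s: "starting w s" "ireg s 8 = L" for s :: "'a state"
  proof -
    define s1 where "s1 = tick (tick (tick (tick (s\<lparr>ireg := (ireg s)(7 := X, 5 := 1, 10 := 2,
      11 := X div 2)\<rparr>))))"
    have s1: "starting w s1" "ireg s1 7 = X" "ireg s1 10 = Suc (ireg s1 5)"
      "ireg s1 11 = X div Suc (ireg s1 5)" "ireg s1 5 = 1" "ireg s1 8 = L"
      using s by (auto simp: s1_def starting_def tick_def numeral_2_eq_2)
    have "wp M (Loop (Leq 10 11) (IArith 5 Plus 10 4;; IArith 10 Plus 10 6;; IArith 11 Div 7 10)) s1
           (\<lambda>s'. starting w s' \<and> ireg s' 8 = ireg s1 8 \<and> ireg s' 5 = floor_sqrt X)"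
      using s1 X by (intro wp_sqrt_loop) simp_all
    then have "wp M (Loop (Leq 10 11) (IArith 5 Plus 10 4;; IArith 10 Plus 10 6;; IArith 11 Div 7 10)) s1
           (\<lambda>s'. wp M (IArith 5 Times 5 8;; IConst 0 1) s' (\<lambda>s. timely B s \<and> stream s = w \<and>
             represents M (width M)
               \<lparr>ok = True, prev = None, buf = [], depth = 0, pending = [], peak = 0\<rparr> s))"
    proof (rule wp_mono, elim conjE)
      fix s' assume s': "starting w s'" "ireg s' 8 = ireg s1 8" "ireg s' 5 = floor_sqrt X"
      have width: "width M = ireg s' 5 * ireg s' 8"
        by (simp add: width_def s' s1 X_def L_def)
      show "wp M (IArith 5 Times 5 8;; IConst 0 1) s' (\<lambda>s. timely B s \<and> stream s = w \<and>
             represents M (width M)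
               \<lparr>ok = True, prev = None, buf = [], depth = 0, pending = [], peak = 0\<rparr> s)"
        using s'(1) M width_le[of M] unfolding width
        by (auto simp: wp_simps tick_def represents_def starting_def timely_def buf_at_def)
    qed
    moreover have "X \<le> M" "X div 2 \<le> M" using X by simp_all
    ultimately show ?thesis
      using s M unfolding s1_def sqrt_com_def by (simp add: wp_simps tick_def X_def starting_def)
  qed
  ultimately have "wp M (Loop (Leq 6 7) (IArith 7 Div 7 9;; IArith 8 Plus 8 6)) s0 (\<lambda>s.
     wp M sqrt_com s (\<lambda>s. timely B s \<and> stream s = w \<and> represents M (width M)
       \<lparr>ok = True, prev = None, buf = [], depth = 0, pending = [], peak = 0\<rparr> s))"
    by (rule wp_mono) auto
  moreover have "wp M setup_com (init w) Q \<longleftrightarrow>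
      wp M (Loop (Leq 6 7) (IArith 7 Div 7 9;; IArith 8 Plus 8 6)) s0 (\<lambda>s. wp M sqrt_com s Q)"
    for Q :: "'a state \<Rightarrow> bool"
    using M(2) unfolding setup_com_def
    by (simp add: wp_simps init_def tick_def s0_def M(1)[symmetric])
  ultimately show ?thesis by simp
qed

section \<open>Space\<close>

lemma width_squared_le: "(width M)\<^sup>2 \<le> M * ceillog2 (M + 1)"
proof -
  define L where "L = ceillog2 (M + 1)"
  have "(floor_sqrt (M div L) * L)\<^sup>2 = (floor_sqrt (M div L))\<^sup>2 * L * L"
    by (simp add: power2_eq_square)
  also have "\<dots> \<le> M div L * L * L"
    by (intro mult_right_mono floor_sqrt_power2_le) simp_all
  also have "\<dots> \<le> M * L"
    by (intro mult_right_mono) simp_all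
  finally show ?thesis unfolding width_def L_def .
qed

text \<open>Rounding costs a factor 2 only: \<open>M * L \<le> (2 * K)\<^sup>2\<close> for
  \<open>K = width M\<close>. Together with \<open>h * K \<le> N\<close> this yields
  \<open>h\<^sup>2 * L \<le> M\<close>.\<close>

lemma height_squared_le:
  assumes "0 < M" "M = 2 * N"
  shows "(N div width M * ceillog2 (M + 1))\<^sup>2 \<le> M * ceillog2 (M + 1)"
proof -
  define L where "L = ceillog2 (M + 1)"
  define q where "q = floor_sqrt (M div L)"
  define h where "h = N div width M"
  have L: "0 < L" "L \<le> M"
    using ceillog2_Suc_pos[of M] ceillog2_Suc_le[of M] assms(1) unfolding L_def by simp_all
  then have q: "1 \<le> q"
    by (simp add: q_def div_greater_zero_iff Suc_le_eq)
  have "M < (M div L + 1) * L"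
    using dividend_less_div_times[OF L(1), of M] by simp
  also have "\<dots> \<le> (Suc q)\<^sup>2 * L"
    using Suc_floor_sqrt_power2_gt[of "M div L"] unfolding q_def by (intro mult_right_mono) simp_all
  also have "\<dots> \<le> (2 * q)\<^sup>2 * L"
    using q by (intro mult_right_mono power_mono) simp_all
  finally have M: "M \<le> 4 * q\<^sup>2 * L" by (simp add: power_mult_distrib)
  have "h * (q * L) \<le> N"
    unfolding h_def width_def q_def L_def[symmetric] by simp
  then have "(2 * (h * (q * L)))\<^sup>2 \<le> M\<^sup>2"
    unfolding assms(2) by (intro power_mono) simp_all
  then have "h\<^sup>2 * L * (4 * q\<^sup>2 * L) \<le> M * M"
    by (simp add: power2_eq_square algebra_simps)
  then have "h\<^sup>2 * L * M \<le> M * M"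
    using mult_left_mono[OF M, of "h\<^sup>2 * L"] by linarith
  then have "h\<^sup>2 * L \<le> M"
    using assms(1) by simp
  then have "h\<^sup>2 * L * L \<le> M * L"
    by (rule mult_right_mono) simp
  then show ?thesis
    unfolding h_def[symmetric] L_def[symmetric] by (simp add: power2_eq_square algebra_simps)
qed

text \<open>As \<open>2 * N + 1 \<le> 4 * N\<close>, the left side is below
  \<open>3 + log 2 N\<close>, and \<open>N \<ge> 2\<close> lets the logarithm absorb the 3.\<close>

lemma ceillog2_le_log:
  assumes "2 \<le> N"
  shows "real (ceillog2 (2 * N + 1)) \<le> 4 * log 2 (real N)"
proof -
  have "ceillog2 (2 * N + 1) \<le> ceillog2 (2 * (2 * N))"
    using assms by (intro ceillog2_mono) simp
  also have "\<dots> = Suc (Suc (ceillog2 N))"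
    using assms by (subst ceillog2_rec_even; simp)+
  finally have "real (ceillog2 (2 * N + 1)) \<le> 2 + real (ceillog2 N)" by linarith
  also have "real (ceillog2 N) < log 2 (real N) + 1"
    using assms by (intro ceillog2_less_log) simp
  finally have "real (ceillog2 (2 * N + 1)) < 3 + log 2 (real N)" by simp
  moreover have "1 \<le> log 2 (real N)"
    using assms by (simp add: le_log_iff)
  ultimately show ?thesis by linarith
qed

text \<open>\<open>a\<close> and \<open>b\<close> stand for the numbers of integer and letter
  registers; the cells are those allowed by \<open>represents\<close> when \<open>peak\<close> is
  \<open>N div K\<close>.\<close>

definition space_bound :: "nat \<Rightarrow> nat \<Rightarrow> nat \<Rightarrow> nat" where
  "space_bound a b N =
     (a + Suc (N div width (2 * N))) * ceillog2 (2 * N + 1) +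
     (b + Suc (width (2 * N) + N div width (2 * N)))"

lemma space_bound_bigo:
  "(\<lambda>N. real (space_bound a b N)) \<in> O(\<lambda>N. sqrt (real N * log 2 (real N)))"
proof (rule bigoI)
  \<comment> \<open>Each of the five quantities \<open>L\<close>, \<open>h * L\<close>,
    \<open>K\<close>, \<open>h\<close> and 1 is at most \<open>R = sqrt (M * L)\<close>, and
    \<open>M * L \<le> 8 * N * log 2 N\<close>.\<close>
  show "\<forall>\<^sub>F N in at_top. norm (real (space_bound a b N))
      \<le> (real (a + b + 5) * sqrt 8) * norm (sqrt (real N * log 2 (real N)))"
    using eventually_ge_at_top[of 2]
  proof eventually_elim
    case (elim N)
    define M where "M = 2 * N"
    define L where "L = ceillog2 (M + 1)"
    define K where "K = width M"
    define h where "h = N div K"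
    define R where "R = sqrt (real (M * L))"
    have M: "0 < M" using elim by (simp add: M_def)
    have L: "1 \<le> L" "L \<le> M"
      using ceillog2_Suc_pos[OF M] ceillog2_Suc_le[of M] unfolding L_def by simp_all
    have le: "real n \<le> R" if "n\<^sup>2 \<le> M * L" for n
      unfolding R_def using that by (intro real_le_rsqrt) (metis of_nat_le_iff of_nat_power)
    have K: "real K \<le> R"
      by (rule le) (use width_squared_le[of M] in \<open>simp add: K_def L_def\<close>)
    have hL: "real (h * L) \<le> R"
      by (rule le) (use height_squared_le[OF M M_def] in \<open>simp add: h_def K_def L_def\<close>)
    have LR: "real L \<le> R"
      by (rule le) (use L in \<open>simp add: power2_eq_square\<close>)
    have R1: "1 \<le> R" using LR L by linarith
    have "h \<le> h * L" using L by simp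
    then have h: "real h \<le> R" using hL by linarith
    have "real (space_bound a b N) = real a * real L + real L + real (h * L) + real b + 1 + real K + real h"
      unfolding space_bound_def M_def[symmetric] L_def[symmetric] K_def[symmetric] h_def[symmetric]
      by (simp add: algebra_simps)
    also have "\<dots> \<le> real a * R + R + R + real b * R + R + R + R"
      using LR hL K h R1 mult_left_mono[OF R1, of "real b"]
      by (intro add_mono mult_left_mono) simp_all
    also have "\<dots> = real (a + b + 5) * R" by (simp add: algebra_simps)
    also have "R \<le> sqrt (8 * (real N * log 2 (real N)))"
      unfolding R_def using mult_left_mono[OF ceillog2_le_log[OF elim], of "2 * real N"]
      by (simp add: M_def L_def)
    also have "\<dots> = sqrt 8 * sqrt (real N * log 2 (real N))"
      by (simp add: real_sqrt_mult)
    also have "\<dots> \<le> sqrt 8 * norm (sqrt (real N * log 2 (real N)))"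
      by (intro mult_left_mono) simp_all
    finally show ?case by (simp add: mult.assoc mult_left_mono)
  qed
qed

section \<open>Validity, time and space combined\<close>

theorem theorem1:
  fixes r :: "'a::finite" and D :: "'a dtd"
  shows "\<exists>(P :: 'a com) (S :: nat \<Rightarrow> nat) (T :: nat).
     (\<lambda>N. real (S N)) \<in> O(\<lambda>N. sqrt (real N * log 2 (real N))) \<and>
     (\<forall>t :: 'a tree. binary t \<longrightarrow> label t = r \<longrightarrow>
       (\<exists>s. exec (length (xml t)) P (init (xml t)) s \<and>
            (accepting s \<longleftrightarrow> valid D t) \<and>
            space_used (length (xml t)) P s \<le> S (nodes t) \<and>
            processing_time s \<le> T))"
proof -
  let ?P = "validator D"
  let ?a = "card (insert 0 (iregs ?P))" and ?b = "card (lregs ?P)"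
  show ?thesis
  proof (rule exI[of _ ?P], rule exI[of _ "space_bound ?a ?b"], rule exI[of _ 31],
      intro conjI allI impI)
    show "(\<lambda>N. real (space_bound ?a ?b N)) \<in> O(\<lambda>N. sqrt (real N * log 2 (real N)))"
      by (rule space_bound_bigo)
    fix t :: "'a tree" assume t: "binary t"
    define w where "w = xml t"
    define M where "M = length w"
    define N where "N = nodes t"
    define K where "K = width M"
    define c :: "'a config"
      where "c = \<lparr>ok = True, prev = None, buf = [], depth = 0, pending = [], peak = 0\<rparr>"
    have M: "M = 2 * N" by (simp add: M_def N_def w_def length_xml)
    have N: "0 < N" unfolding N_def by (cases t) simp
    have K: "0 < K" "K \<le> M" unfolding K_def using width_pos[of M] width_le[of M] M N by simp_all
    from steps_xml[OF t K(1), of D]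
    have final: "ok (steps D K c w) \<longleftrightarrow> valid D t" "peak (steps D K c w) \<le> N div K"
      by (simp_all add: c_def w_def N_def)
    \<comment> \<open>All letter addresses must fit into \<open>{0..M}\<close>. If
      \<open>K > N\<close> the stack stays empty; otherwise both summands are at most
      \<open>N\<close>.\<close>
    have "K + N div K \<le> M"
    proof (cases "K \<le> N")
      case True
      then show ?thesis using div_le_dividend[of N K] M by linarith
    next
      case False
      then show ?thesis using K by simp
    qed
    with final(2) have peak: "K + peak (steps D K c w) \<le> M" by linarith
    have "wp M setup_com (init w) (\<lambda>s. timely 30 s \<and> stream s = w \<and> represents M K c s)"
      unfolding K_def c_def using M N by (intro wp_setup[OF M_def]) simp
    then have "wp M ?P (init w) (\<lambda>s. represents M K (steps D K c w) s \<and>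
        (\<forall>n \<in> set (butlast (laps s)). n \<le> 31))"
      unfolding validator_def wp_simps(9)
      by (rule wp_mono) (use wp_main_loop[OF _ _ K(1)] peak in blast)
    then obtain s where s: "exec M ?P (init w) s" "represents M K (steps D K c w) s"
      "\<forall>n \<in> set (butlast (laps s)). n \<le> 31"
      by (auto simp: wp_def)
    show "\<exists>s. exec (length (xml t)) ?P (init (xml t)) s \<and> (accepting s \<longleftrightarrow> valid D t) \<and>
        space_used (length (xml t)) ?P s \<le> space_bound ?a ?b (nodes t) \<and> processing_time s \<le> 31"
    proof (intro exI[of _ s] conjI)
      show "exec (length (xml t)) ?P (init (xml t)) s"
        using s(1) by (simp add: w_def M_def)
      show "accepting s \<longleftrightarrow> valid D t"
        using s(2) final(1) by (simp add: accepting_def represents_def)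
      show "processing_time s \<le> 31"
        using s(3) by (simp add: processing_time_def)
      have "icells s \<le> Suc (N div K)" "lcells s \<le> Suc (K + N div K)"
        using s(2) final(2) by (simp_all add: represents_def)
      then show "space_used (length (xml t)) ?P s \<le> space_bound ?a ?b (nodes t)"
        unfolding space_used_def space_bound_def w_def[symmetric] M_def[symmetric]
          N_def[symmetric] M[symmetric] K_def[symmetric]
        by (intro add_mono mult_right_mono) simp_all
    qed
  qed
qed

end
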